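(* Let $X\in\mathbb{R}^{n\times p}$, $Y\in\mathbb{R}^{n\times q}$, $r=\min\{p,q\}$, and suppose that $X^TY\in\mathbb{R}^{p\times q}$ has at least two different singular values among $\sigma_1(X^TY)\ge\dots\ge\sigma_r(X^TY)$. For $i\in\{1,\dots,r\}$ define $$\lambda_i=\frac{\|X^TY\|_2\,\|X\|_2\,\|Y\|_F}{\|X^TY\|_2-\sigma_i(X^TY)+\|X\|_2\|Y\|_F}.$$ Then for any $i\in\{2,\dots,r\}$ and any $\lambda\in(\lambda_i,\lambda_{i-1}]$, every solution $B^*(\lambda)$ of $\min_{B\in\mathbb{R}^{p\times q}}\{\tfrac12\|Y-XB\|_F^2+\lambda\|B\|_*\}$ satisfies $$\mathrm{rank}(B^*(\lambda))\le i-1.$$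
   Context: For $M\in\mathbb{R}^{p\times q}$, $\sigma_1(M)\ge\dots\ge\sigma_r(M)\ge0$ are its singular values in nonincreasing order (zeros included), $r=\min\{p,q\}$. $\|\cdot\|_F$, $\|\cdot\|_*$, $\|\cdot\|_2$ are the Frobenius, nuclear (sum of singular values) and spectral (largest singular value) norms. *)

theory Defs
  imports "HOL-Analysis.Analysis" "HOL-Computational_Algebra.Polynomial"
begin

text \<open>
  A real \<open>p \<times> q\<close> matrix has type \<open>real^'q^'p\<close> (rows are indexed by \<open>'p\<close>).
\<close>

definition charpoly :: "real^'n^'n \<Rightarrow> real poly" where
  "charpoly A = det (mat [:0, 1:] - map_matrix (\<lambda>c. [:c:]) A)"

text \<open>
  The singular values of \<open>M\<close> are the square roots of the \<open>min p q\<close> largest eigenvalues of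
  \<open>M\<^sup>T M\<close>, counted with multiplicity. The \<open>q \<times> q\<close> matrix \<open>M\<^sup>T M\<close> is symmetric, so its
  characteristic polynomial has \<open>q\<close> real roots; the ones dropped by \<open>take\<close>
  when \<open>p < q\<close> are zeros.
\<close>

definition singular_values :: "real^'q^'p \<Rightarrow> real list" where
  "singular_values M =
     take (min CARD('p) CARD('q))
       (rev (sorted_list_of_multiset (image_mset sqrt (proots (charpoly (transpose M ** M))))))"

text \<open>\<open>singular_value M i\<close> is \<open>\<sigma>\<^sub>i(M)\<close>; it is meant for \<open>1 \<le> i \<le> min p q\<close>.\<close>

definition singular_value :: "real^'q^'p \<Rightarrow> nat \<Rightarrow> real" where
  "singular_value M i = singular_values M ! (i - 1)"

definition spectral_norm :: "real^'q^'p \<Rightarrow> real" where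
  "spectral_norm M = singular_value M 1"

definition nuclear_norm :: "real^'q^'p \<Rightarrow> real" where
  "nuclear_norm M = (\<Sum>i = 1..min CARD('p) CARD('q). singular_value M i)"

definition frobenius_norm :: "real^'q^'p \<Rightarrow> real" where
  "frobenius_norm M = sqrt (\<Sum>i\<in>UNIV. \<Sum>j\<in>UNIV. (M $ i $ j)\<^sup>2)"

lemma frobenius_norm_eq_norm: "frobenius_norm M = norm M"
  by (simp add: frobenius_norm_def norm_vec_def L2_set_def sum_nonneg)

definition nn_objective :: "real^'p^'n \<Rightarrow> real^'q^'n \<Rightarrow> real \<Rightarrow> real^'q^'p \<Rightarrow> real" where
  "nn_objective X Y l B = 1/2 * (frobenius_norm (Y - X ** B))\<^sup>2 + l * nuclear_norm B"

definition nn_solution :: "real^'p^'n \<Rightarrow> real^'q^'n \<Rightarrow> real \<Rightarrow> real^'q^'p \<Rightarrow> bool" where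
  "nn_solution X Y l B \<longleftrightarrow> is_arg_min (nn_objective X Y l) (\<lambda>_. True) B"

definition lambda_bound :: "real^'p^'n \<Rightarrow> real^'q^'n \<Rightarrow> nat \<Rightarrow> real" where
  "lambda_bound X Y i =
     spectral_norm (transpose X ** Y) * spectral_norm X * frobenius_norm Y /
     (spectral_norm (transpose X ** Y) - singular_value (transpose X ** Y) i
        + spectral_norm X * frobenius_norm Y)"

end

(*
  With G = X^T (Y - X B), optimality of B in directions u w^T and -B says that |G x| <= l |x| for
  all x and <G, B> = l ||B||_*; hence |G v| = l |v| on a subspace V of dimension rank B. The scaled
  residual (Y - X B)/l is the projection of Y/l onto the convex set {theta. ||X^T theta||_2 <= 1},
  which contains Y/s for s = ||X^T Y||_2, so it lies within (1/l - 1/s) ||Y||_F of Y/s. Comparing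
  X^T Y with G on V, the Courant-Fischer principle bounds sigma_i(X^T Y) from below whenever
  i <= rank B, and this bound contradicts l > lambda_i.
*)
theory Submission
  imports Defs
begin

text \<open>The definitions read singular values off the characteristic polynomial of M^T M, which
  supplies no vectors. The bridge is an orthonormal basis whose images under M are pairwise
  orthogonal: the norms of the images give the singular values, whichever such basis is taken. Where
  a left singular vector is wanted, \<open>sgn (M *v v)\<close> serves, with value 0 on the kernel.
  The nuclear norm is not differentiable, so optimality is tested only along rays on which it is
  bounded above by a linear function of t. The threshold arises as follows. With a = ||X||_2 ||Y||_F
  the lower bound for sigma_i is s (1 - a (1/l - 1/s)); setting it equal to sigma_i and solving for
  l gives exactly lambda_i. The Frobenius norm of Y enters because the projection lives in Frobenius
  geometry, and its distance estimate is then used as an operator norm bound.\<close>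

section \<open>Spectral theorem for self-adjoint maps\<close>

text \<open>Divide by t and let t tend to 0. This is the first-order condition both for the Rayleigh
  quotient and for the optimality of B.\<close>

lemma nonneg_linear_coeff:
  fixes a c :: real
  assumes "\<And>t. 0 < t \<Longrightarrow> t \<le> 1 \<Longrightarrow> 0 \<le> t * a + t\<^sup>2 * c"
  shows "0 \<le> a"
proof (rule ccontr)
  assume a: "\<not> 0 \<le> a"
  \<comment> \<open>Small enough that the quadratic term eats at most half of -a; the +1 avoids a
    zero denominator.\<close>
  define t where "t = min 1 (- a / (2 * (\<bar>c\<bar> + 1)))"
  have t: "0 < t" "t \<le> 1" "t \<le> - a / (2 * (\<bar>c\<bar> + 1))"
    using a by (auto simp: t_def intro!: divide_neg_pos)
  have "t * c \<le> t * (\<bar>c\<bar> + 1)"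
    using t by (intro mult_left_mono) auto
  also have "\<dots> \<le> - a / 2"
    using t(3) by (simp add: field_simps)
  finally have "a + t * c < 0"
    using a by simp
  then have "t * (a + t * c) < 0"
    using t(1) by (simp add: mult_pos_neg)
  with assms[OF t(1,2)] show False
    by (simp add: algebra_simps power2_eq_square)
qed

text \<open>A maximiser of the Rayleigh quotient on the unit sphere of S is an eigenvector: its
  first variation vanishes in the directions of S, and invariance puts the residual T v - \<mu> v
  among them.\<close>

lemma constrained_eigenvector:
  fixes T :: "'a::euclidean_space \<Rightarrow> 'a"
  assumes lin: "linear T" and sa: "\<And>x y. T x \<bullet> y = x \<bullet> T y"
    and sub: "subspace S" and inv: "T ` S \<subseteq> S" and S: "S \<noteq> {0}"
  obtains v where "v \<in> S" "norm v = 1" "T v = (v \<bullet> T v) *\<^sub>R v"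
proof -
  let ?K = "sphere 0 1 \<inter> S"
  obtain x where x: "x \<in> S" "x \<noteq> 0"
    using S subspace_0[OF sub] by blast
  have "(1 / norm x) *\<^sub>R x \<in> ?K"
    using x sub by (simp add: subspace_scale)
  moreover have "compact ?K"
    by (simp add: closed_subspace sub compact_Int_closed)
  moreover have "continuous_on ?K (\<lambda>x. x \<bullet> T x)"
    using lin by (intro continuous_intros linear_continuous_on) (simp add: linear_conv_bounded_linear)
  ultimately obtain v where v: "v \<in> ?K" and max: "\<And>y. y \<in> ?K \<Longrightarrow> y \<bullet> T y \<le> v \<bullet> T v"
    using continuous_attains_sup[of ?K "\<lambda>x. x \<bullet> T x"] by blast
  define \<mu> where "\<mu> = v \<bullet> T v"
  have le: "y \<bullet> T y \<le> \<mu> * (y \<bullet> y)" if y: "y \<in> S" for y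
  proof (cases "y = 0")
    case False
    have "(1 / norm y) *\<^sub>R y \<in> ?K"
      using y False sub by (simp add: subspace_scale)
    from max[OF this] have "(y \<bullet> T y) / (norm y)\<^sup>2 \<le> \<mu>"
      by (simp add: linear_scale[OF lin] \<mu>_def power2_eq_square)
    then show ?thesis
      using False by (simp add: divide_le_eq power2_norm_eq_inner)
  qed simp
  have pos: "0 \<le> w \<bullet> (\<mu> *\<^sub>R v - T v)" if w: "w \<in> S" for w
  proof -
    \<comment> \<open>This is \<open>le\<close> at v + t w; the constant terms cancel because
      \<open>le\<close> is an equality at v.\<close>
    have "0 \<le> t * (2 * (w \<bullet> (\<mu> *\<^sub>R v - T v))) + t\<^sup>2 * (\<mu> * (w \<bullet> w) - w \<bullet> T w)" for t
    proof -
      have "v + t *\<^sub>R w \<in> S"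
        using v w sub by (simp add: subspace_add subspace_scale)
      moreover have "v \<bullet> T w = w \<bullet> T v"
        using sa[of v w] by (simp add: inner_commute)
      moreover have "v \<bullet> v = 1"
        using v by (simp add: norm_eq_1)
      ultimately show ?thesis
        using le[of "v + t *\<^sub>R w"]
        by (simp add: linear_add[OF lin] linear_scale[OF lin] inner_simps inner_commute[of v w] \<mu>_def[symmetric])
           (simp add: algebra_simps power2_eq_square)
    qed
    from nonneg_linear_coeff[OF this] show ?thesis by simp
  qed
  define z where "z = T v - \<mu> *\<^sub>R v"
  have "z \<in> S"
    using v sub inv unfolding z_def by (intro subspace_diff subspace_scale) auto
  from pos[OF this] have "z \<bullet> z \<le> 0"
    by (simp add: z_def inner_simps)
  then have "z = 0"
    by (meson inner_gt_zero_iff not_le)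
  then show thesis
    using that[of v] v by (simp add: z_def \<mu>_def)
qed

text \<open>Split off one eigenvector and recurse into its orthogonal complement within S, which
  self-adjointness keeps invariant.\<close>

lemma selfadjoint_eigenbasis:
  fixes T :: "'a::euclidean_space \<Rightarrow> 'a"
  assumes lin: "linear T" and sa: "\<And>x y. T x \<bullet> y = x \<bullet> T y"
    and "subspace S" "T ` S \<subseteq> S"
  shows "\<exists>E\<subseteq>S. finite E \<and> card E = dim S \<and> pairwise orthogonal E \<and>
           (\<forall>v\<in>E. norm v = 1 \<and> T v = (v \<bullet> T v) *\<^sub>R v)"
  using assms(3,4)
proof (induction "dim S" arbitrary: S)
  case 0
  then show ?case
    by (intro exI[of _ "{}"]) auto
next
  case (Suc d)
  then have "S \<noteq> {0}"
    by auto
  then obtain v where v: "v \<in> S" "norm v = 1" "T v = (v \<bullet> T v) *\<^sub>R v"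
    using constrained_eigenvector[OF lin sa Suc.prems] by blast
  define S' where "S' = {y \<in> S. \<forall>x\<in>span {v}. orthogonal x y}"
  have S': "S' = {y \<in> S. orthogonal v y}"
    by (auto simp: S'_def orthogonal_commute[of _ "_ :: 'a"] intro: orthogonal_to_span span_base)
  have "span {v} \<subseteq> S"
    using v(1) Suc.prems(1) by (simp add: span_minimal)
  moreover have "v \<noteq> 0"
    using v(2) by auto
  then have "dim (span {v}) = 1"
    by simp
  ultimately have "d = dim S'"
    using dim_subspace_orthogonal_to_vectors[OF subspace_span Suc.prems(1), of "{v}"] Suc.hyps(2)
    by (simp add: S'_def)
  moreover have "subspace S'"
    using Suc.prems(1) by (auto simp: S' subspace_def orthogonal_def inner_simps)
  moreover have "T ` S' \<subseteq> S'"
  proof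
    fix z assume "z \<in> T ` S'"
    then obtain y where y: "y \<in> S" "v \<bullet> y = 0" "z = T y"
      by (auto simp: S' orthogonal_def)
    have "v \<bullet> T y = T v \<bullet> y"
      by (simp add: sa)
    also have "\<dots> = 0"
      by (subst v(3)) (simp add: y)
    finally show "z \<in> S'"
      using y Suc.prems(2) by (auto simp: S' orthogonal_def)
  qed
  ultimately obtain E where E: "E \<subseteq> S'" "finite E" "card E = dim S'" "pairwise orthogonal E"
      "\<forall>v\<in>E. norm v = 1 \<and> T v = (v \<bullet> T v) *\<^sub>R v"
    using Suc.hyps(1)[of S'] by blast
  have "v \<notin> E"
    using E(1) \<open>v \<noteq> 0\<close> by (auto simp: S' orthogonal_def)
  then have "card (insert v E) = dim S"
    using E \<open>d = dim S'\<close> Suc.hyps(2) by simp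
  moreover have "pairwise orthogonal (insert v E)"
    using E(1,4) by (auto simp: pairwise_insert S' orthogonal_commute)
  moreover have "insert v E \<subseteq> S"
    using E(1) v(1) by (auto simp: S')
  ultimately show ?case
    using E v by (intro exI[of _ "insert v E"]) auto
qed

section \<open>Orthonormal bases and the Frobenius inner product\<close>

definition orthonormal_basis :: "'a::euclidean_space set \<Rightarrow> bool" where
  "orthonormal_basis E \<longleftrightarrow>
     finite E \<and> card E = DIM('a) \<and> pairwise orthogonal E \<and> (\<forall>v\<in>E. norm v = 1)"

lemma orthonormal_basis_inner:
  assumes "orthonormal_basis E" "v \<in> E" "w \<in> E"
  shows "v \<bullet> w = (if v = w then 1 else 0)"
  using assms by (auto simp: orthonormal_basis_def pairwise_def orthogonal_def norm_eq_1)

lemma orthonormal_independent: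
  assumes "pairwise orthogonal F" "\<forall>v\<in>F. norm v = 1"
  shows "independent F"
  using assms by (intro pairwise_orthogonal_independent) auto

lemma orthonormal_basis_span:
  assumes "orthonormal_basis (E :: 'a::euclidean_space set)"
  shows "span E = UNIV"
proof -
  have "independent E"
    using assms by (intro orthonormal_independent) (auto simp: orthonormal_basis_def)
  then show ?thesis
    using assms by (metis dim_eq_card_independent dim_eq_full orthonormal_basis_def)
qed

lemma orthonormal_basis_sum:
  assumes "orthonormal_basis E"
  shows "(\<Sum>v\<in>E. (x \<bullet> v) *\<^sub>R v) = x"
  using assms orthonormal_basis_span[OF assms]
  by (intro orthonormal_basis_expand) (auto simp: orthonormal_basis_def)

lemma inner_orthonormal_basis:
  assumes "orthonormal_basis E"
  shows "x \<bullet> y = (\<Sum>v\<in>E. (x \<bullet> v) * (y \<bullet> v))"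
proof -
  have "x \<bullet> y = x \<bullet> (\<Sum>v\<in>E. (y \<bullet> v) *\<^sub>R v)"
    by (simp add: orthonormal_basis_sum[OF assms])
  then show ?thesis
    by (simp add: inner_sum_right mult.commute)
qed

text \<open>The inner product on matrices is the Frobenius one, the trace of A^T M, so it may be
  evaluated in any orthonormal basis; the proof is Parseval row by row.\<close>

lemma inner_matrix_orthonormal_basis:
  fixes A M :: "real^'q^'p"
  assumes "orthonormal_basis E"
  shows "A \<bullet> M = (\<Sum>v\<in>E. (A *v v) \<bullet> (M *v v))"
proof -
  have "A \<bullet> M = (\<Sum>i\<in>UNIV. A $ i \<bullet> M $ i)"
    by (simp add: inner_vec_def)
  also have "\<dots> = (\<Sum>i\<in>UNIV. \<Sum>v\<in>E. (A $ i \<bullet> v) * (M $ i \<bullet> v))"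
    by (subst inner_orthonormal_basis[OF assms]) simp
  also have "\<dots> = (\<Sum>v\<in>E. \<Sum>i\<in>UNIV. (A *v v) $ i * (M *v v) $ i)"
    by (subst sum.swap) (simp add: matrix_vector_mul_component)
  finally show ?thesis
    by (simp add: inner_vec_def)
qed

lemma transpose_inner:
  fixes M :: "real^'q^'p"
  shows "(transpose M *v x) \<bullet> y = x \<bullet> (M *v y)"
  by (simp add: transpose_matrix_vector dot_lmul_matrix)

section \<open>Singular values through right singular bases\<close>

lemma poly_charpoly: "poly (charpoly A) x = det (mat x - A)"
  unfolding charpoly_def det_def
  by (simp add: poly_sum poly_prod mat_def map_matrix_def if_distrib[of "\<lambda>p. poly p x"])
    (auto intro!: sum.cong prod.cong arg_cong2[of _ _ _ _ "(*)"])

text \<open>For each real x, the orthogonal matrix Q of eigenvectors gives (x - A) Q = Q D with D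
  diagonal. Comparing determinants shows that the two polynomials agree at every point.\<close>

lemma charpoly_eigenbasis:
  fixes A :: "real^'n^'n"
  assumes E: "orthonormal_basis E" and eig: "\<And>v. v \<in> E \<Longrightarrow> A *v v = \<mu> v *\<^sub>R v"
  shows "charpoly A = (\<Prod>v\<in>E. [:- \<mu> v, 1:])"
proof -
  have "finite E" "card E = CARD('n)"
    using E by (auto simp: orthonormal_basis_def)
  \<comment> \<open>The eigenvectors are indexed by the column type so that they form a square
    matrix.\<close>
  then obtain f :: "'n \<Rightarrow> real^'n" where f: "bij_betw f UNIV E"
    using finite_same_card_bij[of "UNIV :: 'n set" E] by auto
  then have fE: "f i \<in> E" for i
    by (auto simp: bij_betw_def)
  define Q :: "real^'n^'n" where "Q = (\<chi> i j. f j $ i)"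
  have col: "(M ** Q) $ i $ j = (M *v f j) $ i" for M :: "real^'n^'n" and i j
    by (simp add: matrix_matrix_mult_def matrix_vector_mult_def Q_def)
  have "transpose Q ** Q = mat 1"
  proof -
    have "(transpose Q ** Q) $ i $ j = f i \<bullet> f j" for i j
      by (simp add: matrix_matrix_mult_def transpose_def Q_def inner_vec_def)
    moreover have "f i = f j \<longleftrightarrow> i = j" for i j
      using f by (auto simp: bij_betw_def inj_on_def)
    ultimately show ?thesis
      by (simp add: vec_eq_iff orthonormal_basis_inner[OF E fE fE] mat_def)
  qed
  then have "det (transpose Q) * det Q = 1"
    by (metis det_I det_mul)
  then have Q: "det Q \<noteq> 0"
    by auto
  have "poly (charpoly A) x = poly (\<Prod>v\<in>E. [:- \<mu> v, 1:]) x" for x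
  proof -
    define D :: "real^'n^'n" where "D = (\<chi> i j. if i = j then x - \<mu> (f j) else 0)"
    have "mat x *v y = x *\<^sub>R y" for y :: "real^'n"
      by (simp add: vec_eq_iff matrix_vector_mult_def mat_def if_distrib[of "\<lambda>u. u * _"] cong: if_cong)
    then have "(mat x - A) *v f j = x *\<^sub>R f j - \<mu> (f j) *\<^sub>R f j" for j
      by (simp add: matrix_vector_mult_diff_rdistrib eig[OF fE])
    then have "(mat x - A) ** Q = Q ** D"
      by (simp only: vec_eq_iff col)
        (simp add: matrix_matrix_mult_def Q_def D_def algebra_simps if_distrib[of "\<lambda>u. _ * u"] cong: if_cong)
    then have "det (mat x - A) * det Q = det D * det Q"
      by (metis det_mul mult.commute)
    then have "det (mat x - A) = det D"
      using Q by simp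
    also have "\<dots> = (\<Prod>i\<in>UNIV. x - \<mu> (f i))"
      by (subst det_diagonal) (auto simp: D_def)
    also have "\<dots> = (\<Prod>v\<in>E. x - \<mu> v)"
      by (rule prod.reindex_bij_betw[OF f])
    finally show ?thesis
      by (simp add: poly_charpoly poly_prod)
  qed
  then show ?thesis
    by (simp add: poly_eq_poly_eq_iff[symmetric] fun_eq_iff)
qed

text \<open>The right factor of a singular value decomposition, with the left factor implicit in the
  directions of the images.\<close>

definition right_singular_basis :: "real^'q^'p \<Rightarrow> (real^'q) set \<Rightarrow> bool" where
  "right_singular_basis M E \<longleftrightarrow>
     orthonormal_basis E \<and> pairwise (\<lambda>v w. orthogonal (M *v v) (M *v w)) E"

lemma right_singular_basis_exists:
  fixes M :: "real^'q^'p"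
  obtains E where "right_singular_basis M E"
proof -
  define T where "T = (\<lambda>x. transpose M *v (M *v x))"
  have T: "T x \<bullet> y = (M *v x) \<bullet> (M *v y)" for x y
    by (simp add: T_def dot_lmul_matrix)
  have "linear T"
    by (simp add: T_def matrix_vector_mul_assoc)
  moreover have "T x \<bullet> y = x \<bullet> T y" for x y
    using T[of x y] T[of y x] by (simp add: inner_commute)
  ultimately obtain E where E: "finite E" "card E = DIM(real^'q)" "pairwise orthogonal E"
      "\<forall>v\<in>E. norm v = 1 \<and> T v = (v \<bullet> T v) *\<^sub>R v"
    using selfadjoint_eigenbasis[of T UNIV] by auto
  have "(M *v v) \<bullet> (M *v w) = 0" if "v \<in> E" "w \<in> E" "v \<noteq> w" for v w
  proof -
    have "(M *v v) \<bullet> (M *v w) = ((v \<bullet> T v) *\<^sub>R v) \<bullet> w"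
      using T[of v w] E(4) that by simp
    then show ?thesis
      using E(3) that by (simp add: pairwise_def orthogonal_def)
  qed
  then show thesis
    using E that[of E] by (simp add: right_singular_basis_def orthonormal_basis_def pairwise_def orthogonal_def)
qed

lemma right_singular_basis_inner:
  assumes "right_singular_basis M E" "v \<in> E" "w \<in> E"
  shows "(M *v v) \<bullet> (M *v w) = (if v = w then (norm (M *v v))\<^sup>2 else 0)"
  using assms by (auto simp: right_singular_basis_def pairwise_def orthogonal_def power2_norm_eq_inner)

text \<open>The coordinate of M^T M v along w is the inner product of M v and M w, which vanishes
  unless w = v. Hence every right singular basis diagonalises M^T M.\<close>

lemma right_singular_basis_eigen:
  assumes "right_singular_basis M E" "v \<in> E"
  shows "(transpose M ** M) *v v = (norm (M *v v))\<^sup>2 *\<^sub>R v"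
proof -
  have E: "orthonormal_basis E" "finite E"
    using assms(1) by (auto simp: right_singular_basis_def orthonormal_basis_def)
  have "(transpose M ** M) *v v = (\<Sum>w\<in>E. ((transpose M *v (M *v v)) \<bullet> w) *\<^sub>R w)"
    by (simp add: orthonormal_basis_sum[OF E(1)] matrix_vector_mul_assoc)
  also have "\<dots> = (\<Sum>w\<in>E. (if w = v then (norm (M *v v))\<^sup>2 *\<^sub>R v else 0))"
    using right_singular_basis_inner[OF assms] by (intro sum.cong) (auto simp: dot_lmul_matrix)
  finally show ?thesis
    using E(2) assms(2) by simp
qed

lemma sum_singleton_eq_image_mset: "finite E \<Longrightarrow> (\<Sum>v\<in>E. {#f v#}) = image_mset f (mset_set E)"
  by (induction E rule: finite_induct) auto

lemma singular_values_right_singular_basis: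
  fixes M :: "real^'q^'p"
  assumes "right_singular_basis M E"
  shows "singular_values M = take (min CARD('p) CARD('q))
           (rev (sorted_list_of_multiset (image_mset (\<lambda>v. norm (M *v v)) (mset_set E))))"
proof -
  have E: "orthonormal_basis E" "finite E"
    using assms by (auto simp: right_singular_basis_def orthonormal_basis_def)
  have "charpoly (transpose M ** M) = (\<Prod>v\<in>E. [:- (norm (M *v v))\<^sup>2, 1:])"
    using right_singular_basis_eigen[OF assms] by (intro charpoly_eigenbasis[OF E(1)])
  then have "proots (charpoly (transpose M ** M)) = image_mset (\<lambda>v. (norm (M *v v))\<^sup>2) (mset_set E)"
    by (simp add: proots_prod sum_singleton_eq_image_mset[OF E(2)])
  then show ?thesis
    by (simp add: singular_values_def multiset.map_comp o_def)
qed

text \<open>L keeps all q norms; the truncation in \<open>singular_values\<close> cuts only the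
  tail, so indices up to min p q are unaffected.\<close>

lemma right_singular_basis_list:
  fixes M :: "real^'q^'p"
  assumes "right_singular_basis M E"
  obtains L where "mset L = image_mset (\<lambda>v. norm (M *v v)) (mset_set E)" "length L = CARD('q)"
    "sorted_wrt (\<ge>) L" "\<And>k. k \<in> {1..min CARD('p) CARD('q)} \<Longrightarrow> singular_value M k = L ! (k - 1)"
proof -
  define L where "L = rev (sorted_list_of_multiset (image_mset (\<lambda>v. norm (M *v v)) (mset_set E)))"
  show thesis
  proof (rule that[of L])
    show mset_L: "mset L = image_mset (\<lambda>v. norm (M *v v)) (mset_set E)"
      by (simp add: L_def)
    have "card E = CARD('q)"
      using assms by (auto simp: right_singular_basis_def orthonormal_basis_def)
    then show "length L = CARD('q)"
      using arg_cong[OF mset_L, of size] by simp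
    show "sorted_wrt (\<ge>) L"
      using sorted_sorted_list_of_multiset by (simp add: L_def sorted_wrt_rev)
    show "singular_value M k = L ! (k - 1)" if "k \<in> {1..min CARD('p) CARD('q)}" for k
    proof -
      have "k - 1 < min CARD('p) CARD('q)"
        using that by auto
      then show ?thesis
        by (simp only: singular_value_def singular_values_right_singular_basis[OF assms] L_def[symmetric] nth_take)
    qed
  qed
qed

lemma card_eq_card_nth:
  assumes "finite E" "mset L = image_mset f (mset_set E)"
  shows "card {v \<in> E. P (f v)} = card {j. j < length L \<and> P (L ! j)}"
proof -
  have "card {j. j < length L \<and> P (L ! j)} = size (filter_mset P (mset L))"
    by (simp add: length_filter_conv_card[symmetric] mset_filter[symmetric] del: mset_filter)
  also have "\<dots> = card {v \<in> E. P (f v)}"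
    using assms by (simp add: filter_mset_image_mset)
  finally show ?thesis by simp
qed

text \<open>In a nonincreasing list only the k - 1 entries before position k - 1 (counted from 0)
  can exceed the entry there.\<close>

lemma card_singular_value_less:
  fixes M :: "real^'q^'p"
  assumes E: "right_singular_basis M E" and k: "k \<in> {1..min CARD('p) CARD('q)}"
  shows "card {v \<in> E. singular_value M k < norm (M *v v)} < k"
proof -
  obtain L where L: "mset L = image_mset (\<lambda>v. norm (M *v v)) (mset_set E)" "length L = CARD('q)"
      "sorted_wrt (\<ge>) L" "singular_value M k = L ! (k - 1)"
    using right_singular_basis_list[OF E] k by metis
  have fin: "finite E"
    using E by (auto simp: right_singular_basis_def orthonormal_basis_def)
  have "{j. j < length L \<and> L ! (k - 1) < L ! j} \<subseteq> {..<k - 1}"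
  proof
    fix j assume j: "j \<in> {j. j < length L \<and> L ! (k - 1) < L ! j}"
    show "j \<in> {..<k - 1}"
    proof (rule ccontr)
      assume "j \<notin> {..<k - 1}"
      then have "k - 1 = j \<or> k - 1 < j"
        by auto
      then show False
        using j sorted_wrt_nth_less[OF L(3), of "k - 1" j] by auto
    qed
  qed
  then have "card {j. j < length L \<and> L ! (k - 1) < L ! j} \<le> k - 1"
    using card_mono[of "{..<k - 1}"] by fastforce
  then have "card {v \<in> E. L ! (k - 1) < norm (M *v v)} \<le> k - 1"
    by (simp only: card_eq_card_nth[OF fin L(1), of "\<lambda>x. L ! (k - 1) < x"])
  then show ?thesis
    using k unfolding L(4) by auto
qed

lemma singular_value_attained:
  fixes M :: "real^'q^'p"
  assumes "k \<in> {1..min CARD('p) CARD('q)}"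
  obtains v where "norm v = 1" "singular_value M k = norm (M *v v)"
proof -
  obtain E where E: "right_singular_basis M E"
    by (rule right_singular_basis_exists)
  obtain L where L: "mset L = image_mset (\<lambda>v. norm (M *v v)) (mset_set E)" "length L = CARD('q)"
      "singular_value M k = L ! (k - 1)"
    using right_singular_basis_list[OF E] assms by metis
  have "L ! (k - 1) \<in># mset L"
    using assms L(2) by auto
  then show thesis
    using that E unfolding L by (auto simp: right_singular_basis_def orthonormal_basis_def)
qed

lemma singular_value_nonneg:
  fixes M :: "real^'q^'p"
  assumes "k \<in> {1..min CARD('p) CARD('q)}"
  shows "0 \<le> singular_value M k"
  using singular_value_attained[OF assms] by (metis norm_ge_zero)

lemma singular_value_antimono:
  fixes M :: "real^'q^'p"
  assumes "j \<le> k" "1 \<le> j" "k \<le> min CARD('p) CARD('q)"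
  shows "singular_value M k \<le> singular_value M j"
proof -
  obtain E where E: "right_singular_basis M E"
    by (rule right_singular_basis_exists)
  obtain L where L: "length L = CARD('q)" "sorted_wrt (\<ge>) L"
      "\<And>k. k \<in> {1..min CARD('p) CARD('q)} \<Longrightarrow> singular_value M k = L ! (k - 1)"
    using right_singular_basis_list[OF E] by metis
  show ?thesis
    using assms L(1) sorted_wrt_nth_less[OF L(2), of "j - 1" "k - 1"] by (cases "j = k") (auto simp: L(3))
qed

text \<open>The nonzero images are pairwise orthogonal and span the range, so they form a basis of
  it.\<close>

lemma card_right_singular_basis_nonzero:
  fixes M :: "real^'q^'p"
  assumes "right_singular_basis M E"
  shows "card {v \<in> E. 0 < norm (M *v v)} = rank M"
proof -
  let ?F = "{v \<in> E. 0 < norm (M *v v)}"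
  have E: "orthonormal_basis E" "finite E"
    using assms by (auto simp: right_singular_basis_def orthonormal_basis_def)
  have orth: "pairwise (\<lambda>v w. orthogonal (M *v v) (M *v w)) ?F"
    using assms by (auto simp: right_singular_basis_def pairwise_def)
  then have "inj_on ((*v) M) ?F"
    unfolding inj_on_def pairwise_def orthogonal_def by (metis (mono_tags, lifting) inner_eq_zero_iff mem_Collect_eq zero_less_norm_iff)
  moreover have "independent ((*v) M ` ?F)"
    using orth by (intro pairwise_orthogonal_independent) (auto simp: pairwise_def)
  moreover have "range ((*v) M) = span ((*v) M ` ?F)"
  proof -
    have "range ((*v) M) = span ((*v) M ` E)"
      by (simp add: linear_span_image orthonormal_basis_span[OF E(1)])
    also have "\<dots> = span ((*v) M ` E - {0})"
      by simp
    also have "(*v) M ` E - {0} = (*v) M ` ?F"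
      by auto
    finally show ?thesis .
  qed
  ultimately show ?thesis
    by (simp add: rank_dim_range dim_eq_card_independent card_image)
qed

text \<open>The right side has q terms, the definition only min p q; the surplus terms vanish by the
  bound on the rank.\<close>

lemma nuclear_norm_right_singular_basis:
  fixes M :: "real^'q^'p"
  assumes E: "right_singular_basis M E"
  shows "nuclear_norm M = (\<Sum>v\<in>E. norm (M *v v))"
proof -
  let ?r = "min CARD('p) CARD('q)"
  obtain L where L: "mset L = image_mset (\<lambda>v. norm (M *v v)) (mset_set E)" "length L = CARD('q)"
      "sorted_wrt (\<ge>) L" "\<And>k. k \<in> {1..?r} \<Longrightarrow> singular_value M k = L ! (k - 1)"
    using right_singular_basis_list[OF E] by metis
  have fin: "finite E"
    using E by (auto simp: right_singular_basis_def orthonormal_basis_def)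
  have nonneg: "0 \<le> x" if "x \<in> set L" for x
    using that by (simp add: set_mset_mset[symmetric] L(1) del: set_mset_mset) auto
  have zero: "L ! k = 0" if k: "k < CARD('q)" "?r \<le> k" for k
  proof (rule ccontr)
    assume "L ! k \<noteq> 0"
    then have "0 < L ! k"
      using nonneg[of "L ! k"] k L(2) by fastforce
    \<comment> \<open>A positive entry at position k makes all k + 1 entries up to it positive, so
      the rank would exceed k and hence min p q.\<close>
    then have "{..k} \<subseteq> {j. j < length L \<and> 0 < L ! j}"
      using sorted_wrt_nth_less[OF L(3), of _ k] k L(2) by (fastforce simp: le_less)
    then have "k < card {j. j < length L \<and> 0 < L ! j}"
      using card_mono[of "{j. j < length L \<and> 0 < L ! j}" "{..k}"] by simp
    then have "k < rank M"
      by (simp add: card_eq_card_nth[OF fin L(1), of "\<lambda>x. 0 < x", symmetric]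
          card_right_singular_basis_nonzero[OF E, simplified])
    with rank_bound[of M] k show False
      by simp
  qed
  have "(\<Sum>v\<in>E. norm (M *v v)) = sum_mset (mset L)"
    by (simp add: L(1) sum_unfold_sum_mset)
  also have "\<dots> = (\<Sum>k<CARD('q). L ! k)"
    by (simp add: sum_mset_sum_list sum_list_sum_nth L(2) atLeast0LessThan)
  also have "\<dots> = (\<Sum>k<?r. L ! k)"
    using zero by (intro sum.mono_neutral_right) auto
  also have "\<dots> = (\<Sum>i = 1..?r. L ! (i - 1))"
    by (rule sum.reindex_bij_witness[of _ "\<lambda>i. i - 1" Suc]) auto
  also have "\<dots> = nuclear_norm M"
    unfolding nuclear_norm_def using L(4) by (intro sum.cong) auto
  finally show ?thesis by simp
qed

section \<open>Courant-Fischer and operator norm bounds\<close>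

lemma norm_sum_orthogonal_eq:
  assumes "finite F" "\<And>v. v \<in> F \<Longrightarrow> norm (g v) = norm (h v)"
    and "pairwise (\<lambda>v w. orthogonal (g v) (g w)) F" "pairwise (\<lambda>v w. orthogonal (h v) (h w)) F"
  shows "norm (\<Sum>v\<in>F. c v *\<^sub>R g v) = norm (\<Sum>v\<in>F. c v *\<^sub>R h v)"
proof -
  have "(norm (\<Sum>v\<in>F. c v *\<^sub>R g v))\<^sup>2 = (\<Sum>v\<in>F. (norm (c v *\<^sub>R g v))\<^sup>2)"
    using assms(1,3) by (intro norm_sum_Pythagorean) (auto simp: pairwise_def orthogonal_def)
  also have "\<dots> = (\<Sum>v\<in>F. (norm (c v *\<^sub>R h v))\<^sup>2)"
    using assms(2) by simp
  also have "\<dots> = (norm (\<Sum>v\<in>F. c v *\<^sub>R h v))\<^sup>2"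
    using assms(1,4) by (intro norm_sum_Pythagorean[symmetric]) (auto simp: pairwise_def orthogonal_def)
  finally show ?thesis
    by simp
qed

lemma norm_sum_orthogonal_le:
  assumes "finite F" "pairwise orthogonal F" "\<forall>v\<in>F. norm v = 1"
    and "pairwise (\<lambda>v w. orthogonal (g v) (g w)) F" "\<And>v. v \<in> F \<Longrightarrow> norm (g v) \<le> c" "0 \<le> c"
  shows "norm (\<Sum>v\<in>F. a v *\<^sub>R g v) \<le> c * norm (\<Sum>v\<in>F. a v *\<^sub>R v)"
proof -
  have "(norm (\<Sum>v\<in>F. a v *\<^sub>R g v))\<^sup>2 = (\<Sum>v\<in>F. (norm (a v *\<^sub>R g v))\<^sup>2)"
    using assms(1,4) by (intro norm_sum_Pythagorean) (auto simp: pairwise_def orthogonal_def)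
  also have "\<dots> \<le> (\<Sum>v\<in>F. c\<^sup>2 * (norm (a v *\<^sub>R v))\<^sup>2)"
  proof (rule sum_mono)
    fix v assume "v \<in> F"
    then have "(norm (g v))\<^sup>2 \<le> c\<^sup>2"
      using assms(5) by (intro power_mono) auto
    then show "(norm (a v *\<^sub>R g v))\<^sup>2 \<le> c\<^sup>2 * (norm (a v *\<^sub>R v))\<^sup>2"
      using assms(3) \<open>v \<in> F\<close> by (simp add: power_mult_distrib mult.commute[of "c\<^sup>2"] mult_left_mono)
  qed
  also have "\<dots> = c\<^sup>2 * (norm (\<Sum>v\<in>F. a v *\<^sub>R v))\<^sup>2"
    using assms(1,2) by (simp add: sum_distrib_left[symmetric])
      (subst norm_sum_Pythagorean, auto simp: pairwise_def orthogonal_def)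
  finally have "(norm (\<Sum>v\<in>F. a v *\<^sub>R g v))\<^sup>2 \<le> (c * norm (\<Sum>v\<in>F. a v *\<^sub>R v))\<^sup>2"
    by (simp add: power_mult_distrib)
  then show ?thesis
    using assms(6) by (simp add: power2_le_iff_abs_le)
qed

lemma right_singular_basis_subset:
  assumes "right_singular_basis M E" "F \<subseteq> E"
  shows "finite F" "pairwise orthogonal F" "\<forall>v\<in>F. norm v = 1"
    "pairwise (\<lambda>v w. orthogonal (M *v v) (M *v w)) F"
  using assms by (auto simp: right_singular_basis_def orthonormal_basis_def finite_subset intro: pairwise_mono)

lemma norm_mult_span_right_singular_basis:
  assumes "right_singular_basis M E" "F \<subseteq> E" "\<And>v. v \<in> F \<Longrightarrow> norm (M *v v) \<le> c" "0 \<le> c" "x \<in> span F"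
  shows "norm (M *v x) \<le> c * norm x"
proof -
  note F = right_singular_basis_subset[OF assms(1,2)]
  have x: "(\<Sum>v\<in>F. (x \<bullet> v) *\<^sub>R v) = x"
    using F assms(5) by (intro orthonormal_basis_expand) auto
  have "M *v x = M *v (\<Sum>v\<in>F. (x \<bullet> v) *\<^sub>R v)"
    by (simp add: x)
  also have "\<dots> = (\<Sum>v\<in>F. (x \<bullet> v) *\<^sub>R (M *v v))"
    by (simp add: linear_sum[OF matrix_vector_mul_linear] linear_scale[OF matrix_vector_mul_linear])
  finally show ?thesis
    using norm_sum_orthogonal_le[OF F assms(3,4), of "\<lambda>v. x \<bullet> v"] by (simp add: x)
qed

text \<open>The half of Courant-Fischer that is used: V meets the span of those right singular
  vectors that M stretches by at most the k-th singular value.\<close>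

lemma singular_value_ge:
  fixes M :: "real^'q^'p"
  assumes V: "subspace V" "k \<le> dim V" and k: "k \<in> {1..min CARD('p) CARD('q)}"
    and c: "\<And>v. v \<in> V \<Longrightarrow> c * norm v \<le> norm (M *v v)"
  shows "c \<le> singular_value M k"
proof -
  obtain E where E: "right_singular_basis M E"
    by (rule right_singular_basis_exists)
  define F where "F = {v \<in> E. norm (M *v v) \<le> singular_value M k}"
  have EF: "E = F \<union> {v \<in> E. singular_value M k < norm (M *v v)}"
    by (auto simp: F_def)
  have "card E \<le> card F + card {v \<in> E. singular_value M k < norm (M *v v)}"
    by (subst EF) (rule card_Un_le)
  \<comment> \<open>Fewer than k basis vectors lie outside F, so dim V + dim (span F) exceeds q and
    the two subspaces share a nonzero vector.\<close>
  then have "CARD('q) < card F + k"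
    using card_singular_value_less[OF E k] E by (auto simp: right_singular_basis_def orthonormal_basis_def)
  moreover have "F \<subseteq> E"
    by (auto simp: F_def)
  note F = right_singular_basis_subset[OF E this]
  have "dim (span F) = card F"
    using orthonormal_independent[OF F(2,3)] by (simp add: dim_eq_card_independent)
  moreover have "dim {x + y |x y. x \<in> V \<and> y \<in> span F} + dim (V \<inter> span F) = dim V + dim (span F)"
    using V(1) by (intro dim_sums_Int) auto
  moreover have "dim {x + y |x y. x \<in> V \<and> y \<in> span F} \<le> CARD('q)"
    using dim_subset_UNIV[of "{x + y |x y. x \<in> V \<and> y \<in> span F}"] by simp
  ultimately have "dim (V \<inter> span F) \<noteq> 0"
    using V(2) by linarith
  then obtain v where v: "v \<in> V" "v \<in> span F" "v \<noteq> 0"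
    by (auto simp: dim_eq_0)
  have "c * norm v \<le> norm (M *v v)"
    using c v(1) .
  also have "\<dots> \<le> singular_value M k * norm v"
    using v(2) singular_value_nonneg[OF k]
    by (intro norm_mult_span_right_singular_basis[OF E \<open>F \<subseteq> E\<close>]) (auto simp: F_def)
  finally show ?thesis
    using v(3) by simp
qed

lemma norm_mult_le_spectral_norm:
  fixes M :: "real^'q^'p"
  shows "norm (M *v x) \<le> spectral_norm M * norm x"
proof -
  have 1: "1 \<in> {1..min CARD('p) CARD('q)}"
    by (simp add: Suc_leI)
  obtain E where E: "right_singular_basis M E"
    by (rule right_singular_basis_exists)
  then have on: "orthonormal_basis E"
    by (simp add: right_singular_basis_def)
  have "{v \<in> E. singular_value M 1 < norm (M *v v)} = {}"
    using card_singular_value_less[OF E 1] on by (simp add: orthonormal_basis_def)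
  then have "norm (M *v v) \<le> spectral_norm M" if "v \<in> E" for v
    using that by (force simp: spectral_norm_def)
  moreover have "0 \<le> spectral_norm M"
    unfolding spectral_norm_def by (rule singular_value_nonneg[OF 1])
  ultimately show ?thesis
    by (intro norm_mult_span_right_singular_basis[OF E order_refl])
      (auto simp: orthonormal_basis_span[OF on])
qed

text \<open>Bounding |M^T y|^2 = <y, M M^T y> by the estimate for M avoids comparing the spectra of
  M^T M and M M^T.\<close>

lemma norm_transpose_mult_le_spectral_norm:
  fixes M :: "real^'q^'p"
  shows "norm (transpose M *v y) \<le> spectral_norm M * norm y"
proof -
  let ?z = "transpose M *v y"
  have "norm ?z * norm ?z = y \<bullet> (M *v ?z)"
    by (metis power2_eq_square power2_norm_eq_inner transpose_inner)
  also have "\<dots> \<le> norm y * norm (M *v ?z)"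
    by (rule norm_cauchy_schwarz)
  also have "\<dots> \<le> norm y * (spectral_norm M * norm ?z)"
    by (intro mult_left_mono norm_mult_le_spectral_norm) simp
  finally have "norm ?z * norm ?z \<le> (spectral_norm M * norm y) * norm ?z"
    by (simp add: mult_ac)
  moreover have "0 \<le> spectral_norm M"
    unfolding spectral_norm_def by (rule singular_value_nonneg) (simp add: Suc_leI)
  ultimately show ?thesis
    by (cases "norm ?z = 0") (auto simp del: transpose_matrix_vector)
qed

section \<open>Duality of the spectral and nuclear norms\<close>

text \<open>Expand in a right singular basis of B and apply Cauchy-Schwarz to each term; both sides
  become sums over the same basis.\<close>

lemma inner_le_nuclear_norm:
  fixes Z B :: "real^'q^'p"
  assumes Z: "\<And>x. norm (Z *v x) \<le> c * norm x"
  shows "Z \<bullet> B \<le> c * nuclear_norm B"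
proof -
  obtain E where E: "right_singular_basis B E"
    by (rule right_singular_basis_exists)
  then have on: "orthonormal_basis E"
    by (simp add: right_singular_basis_def)
  have "(Z *v v) \<bullet> (B *v v) \<le> c * norm (B *v v)" if "v \<in> E" for v
  proof -
    have "(Z *v v) \<bullet> (B *v v) \<le> norm (Z *v v) * norm (B *v v)"
      by (rule norm_cauchy_schwarz)
    also have "\<dots> \<le> c * norm (B *v v)"
      using Z[of v] that on by (intro mult_right_mono) (auto simp: orthonormal_basis_def)
    finally show ?thesis .
  qed
  then show ?thesis
    by (simp add: inner_matrix_orthonormal_basis[OF on] nuclear_norm_right_singular_basis[OF E]
        sum_distrib_left sum_mono)
qed

lemma nuclear_norm_attained:
  fixes B :: "real^'q^'p"
  obtains Z where "\<And>x. norm (Z *v x) \<le> norm x" "Z \<bullet> B = nuclear_norm B"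
proof -
  obtain E where E: "right_singular_basis B E"
    by (rule right_singular_basis_exists)
  then have on: "orthonormal_basis E"
    by (simp add: right_singular_basis_def)
  note F = right_singular_basis_subset[OF E order_refl]
  \<comment> \<open>The partial isometry of the polar decomposition of B: it sends v to the
    direction of B v, and to 0 when B v = 0.\<close>
  define f where "f = (\<lambda>x. \<Sum>v\<in>E. (x \<bullet> v) *\<^sub>R sgn (B *v v))"
  have "linear f"
    by (rule linearI) (simp_all add: f_def inner_simps scaleR_add_left sum.distrib scaleR_sum_right)
  then have Z: "matrix f *v x = f x" for x
    by (simp add: matrix_works linear_matrix_vector_mul_eq)
  have "norm (f x) \<le> 1 * norm (\<Sum>v\<in>E. (x \<bullet> v) *\<^sub>R v)" for x
  proof -
    have "pairwise (\<lambda>v w. orthogonal (sgn (B *v v)) (sgn (B *v w))) E"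
      using F(4) by (auto simp: sgn_div_norm pairwise_def orthogonal_def)
    then show ?thesis
      unfolding f_def by (intro norm_sum_orthogonal_le[OF F(1-3)]) (auto simp: norm_sgn)
  qed
  moreover have "f w \<bullet> (B *v w) = norm (B *v w)" if "w \<in> E" for w
  proof -
    have "f w = (\<Sum>v\<in>E. if v = w then sgn (B *v w) else 0)"
      unfolding f_def using that by (intro sum.cong) (auto simp: orthonormal_basis_inner[OF on])
    also have "\<dots> = sgn (B *v w)"
      using that F(1) by simp
    finally show ?thesis
      by (cases "B *v w = 0") (simp_all add: sgn_div_norm power2_norm_eq_inner[symmetric] power2_eq_square)
  qed
  ultimately show thesis
    by (intro that[of "matrix f"])
      (simp_all add: Z orthonormal_basis_sum[OF on] inner_matrix_orthonormal_basis[OF on]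
        nuclear_norm_right_singular_basis[OF E])
qed

text \<open>The triangle inequality, with the nuclear norm of D replaced by any bound d on its
  pairings with contractions. For a rank-one D such a d is immediate, without computing singular
  values.\<close>

lemma nuclear_norm_add_le:
  fixes B D :: "real^'q^'p"
  assumes D: "\<And>Z. (\<And>x. norm (Z *v x) \<le> norm x) \<Longrightarrow> Z \<bullet> D \<le> d" and "0 \<le> t"
  shows "nuclear_norm (B + t *\<^sub>R D) \<le> nuclear_norm B + t * d"
proof -
  obtain Z where Z: "\<And>x. norm (Z *v x) \<le> norm x" "Z \<bullet> (B + t *\<^sub>R D) = nuclear_norm (B + t *\<^sub>R D)"
    by (rule nuclear_norm_attained) blast
  have "Z \<bullet> B \<le> 1 * nuclear_norm B"
    using Z(1) by (intro inner_le_nuclear_norm) simp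
  moreover have "t * (Z \<bullet> D) \<le> t * d"
    using D[OF Z(1)] \<open>0 \<le> t\<close> by (rule mult_left_mono)
  ultimately show ?thesis
    by (simp add: Z(2)[symmetric] inner_add_right)
qed

lemma inner_transpose_mult:
  fixes X :: "real^'p^'n" and A :: "real^'q^'n"
  shows "(transpose X ** A) \<bullet> D = A \<bullet> (X ** D)"
proof -
  have "orthonormal_basis (Basis :: (real^'q) set)"
    by (auto simp: orthonormal_basis_def pairwise_def orthogonal_def inner_not_same_Basis)
  note inner = inner_matrix_orthonormal_basis[OF this]
  show ?thesis
    by (simp add: inner[of _ D] inner[of A] matrix_vector_mul_assoc[symmetric] dot_lmul_matrix)
qed

section \<open>Optimality conditions\<close>

text \<open>The quadratic part expands exactly along the ray, and the nuclear norm is replaced by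
  its linear upper bound with slope d; what remains is a nonnegative quadratic in t without constant
  term.\<close>

lemma nn_solution_variation:
  fixes X :: "real^'p^'n"
  assumes sol: "nn_solution X Y l B" and l: "0 \<le> l"
    and d: "\<And>t. 0 < t \<Longrightarrow> t \<le> 1 \<Longrightarrow> nuclear_norm (B + t *\<^sub>R D) \<le> nuclear_norm B + t * d"
  shows "(transpose X ** (Y - X ** B)) \<bullet> D \<le> l * d"
proof -
  let ?R = "Y - X ** B"
  have "0 \<le> t * (l * d - ?R \<bullet> (X ** D)) + t\<^sup>2 * ((norm (X ** D))\<^sup>2 / 2)" if t: "0 < t" "t \<le> 1" for t
  proof -
    have "nn_objective X Y l B \<le> nn_objective X Y l (B + t *\<^sub>R D)"
      using sol by (force simp: nn_solution_def is_arg_min_def not_less)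
    moreover have "Y - X ** (B + t *\<^sub>R D) = ?R - t *\<^sub>R (X ** D)"
      by (simp add: matrix_add_ldistrib matrix_scalar_ac scalar_matrix_assoc flip: scalar_mult_eq_scaleR)
    moreover have "l * nuclear_norm (B + t *\<^sub>R D) \<le> l * (nuclear_norm B + t * d)"
      using d[OF t] l by (rule mult_left_mono)
    moreover have "(norm (?R - t *\<^sub>R (X ** D)))\<^sup>2
        = (norm ?R)\<^sup>2 - 2 * t * (?R \<bullet> (X ** D)) + t\<^sup>2 * (norm (X ** D))\<^sup>2"
      by (simp only: power2_norm_eq_inner) (simp add: inner_simps inner_commute power2_eq_square algebra_simps)
    ultimately show ?thesis
      by (simp add: nn_objective_def frobenius_norm_eq_norm algebra_simps)
  qed
  from nonneg_linear_coeff[OF this] show ?thesis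
    by (simp add: inner_transpose_mult)
qed

lemma nn_solution_dual_feasible:
  fixes X :: "real^'p^'n"
  assumes sol: "nn_solution X Y l B" and l: "0 \<le> l"
  shows "norm ((transpose X ** (Y - X ** B)) *v w) \<le> l * norm w"
proof -
  define G where "G = transpose X ** (Y - X ** B)"
  \<comment> \<open>With D = u w^T, the pairing of G with D is <G w, u>; choosing u = G w turns it
    into |G w|^2.\<close>
  define u where "u = G *v w"
  define D where "D = (\<chi> i j. u $ i * w $ j)"
  have D: "Z \<bullet> D = (Z *v w) \<bullet> u" for Z
    by (simp add: D_def inner_vec_def matrix_vector_mult_def sum_distrib_left sum_distrib_right mult_ac)
  have "Z \<bullet> D \<le> norm w * norm u" if "\<And>x. norm (Z *v x) \<le> norm x" for Z
  proof -
    have "Z \<bullet> D \<le> norm (Z *v w) * norm u"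
      unfolding D by (rule norm_cauchy_schwarz)
    also have "\<dots> \<le> norm w * norm u"
      using that by (intro mult_right_mono) auto
    finally show ?thesis .
  qed
  then have "G \<bullet> D \<le> l * (norm w * norm u)"
    unfolding G_def by (intro nn_solution_variation[OF sol l] nuclear_norm_add_le) auto
  then have "norm u * norm u \<le> (l * norm w) * norm u"
    unfolding D u_def[symmetric] by (simp add: power2_eq_square power2_norm_eq_inner[symmetric] mult_ac)
  then have "norm u \<le> l * norm w"
    using l by (cases "u = 0") auto
  then show ?thesis
    by (simp add: u_def G_def)
qed

lemma nn_solution_dual_attained:
  fixes X :: "real^'p^'n"
  assumes sol: "nn_solution X Y l B" and l: "0 \<le> l"
  shows "(transpose X ** (Y - X ** B)) \<bullet> B = l * nuclear_norm B"
proof (rule antisym)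
  show "(transpose X ** (Y - X ** B)) \<bullet> B \<le> l * nuclear_norm B"
    by (intro inner_le_nuclear_norm nn_solution_dual_feasible[OF sol l])
  \<comment> \<open>Shrinking B gives the negative slope that yields the reverse inequality; t \<le>
    1 keeps the factor 1 - t nonnegative.\<close>
  have "nuclear_norm (B + t *\<^sub>R (- B)) \<le> nuclear_norm B + t * (- nuclear_norm B)"
    if t: "0 < t" "t \<le> 1" for t
  proof -
    have eq: "B + t *\<^sub>R (- B) = (1 - t) *\<^sub>R B"
      by (simp add: algebra_simps)
    obtain Z where Z: "\<And>x. norm (Z *v x) \<le> norm x" "Z \<bullet> ((1 - t) *\<^sub>R B) = nuclear_norm ((1 - t) *\<^sub>R B)"
      by (rule nuclear_norm_attained) blast
    have "(1 - t) * (Z \<bullet> B) \<le> (1 - t) * (1 * nuclear_norm B)"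
      using t Z(1) by (intro mult_left_mono inner_le_nuclear_norm) auto
    then show ?thesis
      unfolding eq Z(2)[symmetric] by (simp add: algebra_simps)
  qed
  from nn_solution_variation[OF sol l this]
  show "l * nuclear_norm B \<le> (transpose X ** (Y - X ** B)) \<bullet> B"
    by simp
qed

text \<open>Equality in the duality bound forces equality in Cauchy-Schwarz at each right singular
  vector v of B. Where B v is nonzero this determines G v as l times a unit vector, and these unit
  vectors are orthogonal.\<close>

lemma isometric_subspace_of_dual:
  fixes G B :: "real^'q^'p"
  assumes l: "0 \<le> l" and feas: "\<And>x. norm (G *v x) \<le> l * norm x" and att: "G \<bullet> B = l * nuclear_norm B"
  obtains V where "subspace V" "dim V = rank B" "\<And>v. v \<in> V \<Longrightarrow> norm (G *v v) = l * norm v"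
proof -
  obtain E where E: "right_singular_basis B E"
    by (rule right_singular_basis_exists)
  then have on: "orthonormal_basis E" and fin: "finite E"
    by (auto simp: right_singular_basis_def orthonormal_basis_def)
  define F where "F = {v \<in> E. 0 < norm (B *v v)}"
  have FE: "F \<subseteq> E"
    by (auto simp: F_def)
  note F = right_singular_basis_subset[OF E FE]
  have le: "(G *v v) \<bullet> (B *v v) \<le> l * norm (B *v v)" if "v \<in> E" for v
  proof -
    have "(G *v v) \<bullet> (B *v v) \<le> norm (G *v v) * norm (B *v v)"
      by (rule norm_cauchy_schwarz)
    also have "\<dots> \<le> l * norm (B *v v)"
      using feas[of v] that on by (intro mult_right_mono) (auto simp: orthonormal_basis_def)
    finally show ?thesis .
  qed
  have "(\<Sum>v\<in>E. l * norm (B *v v) - (G *v v) \<bullet> (B *v v)) = 0"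
    using att by (simp add: inner_matrix_orthonormal_basis[OF on] nuclear_norm_right_singular_basis[OF E]
        sum_subtractf sum_distrib_left)
  then have eq: "(G *v v) \<bullet> (B *v v) = l * norm (B *v v)" if "v \<in> E" for v
    using that le by (subst (asm) sum_nonneg_eq_0_iff[OF fin]) auto
  have G: "G *v v = l *\<^sub>R sgn (B *v v)" if v: "v \<in> F" for v
  proof -
    let ?u = "sgn (B *v v)"
    have u: "norm ?u = 1" "(G *v v) \<bullet> ?u = l"
      using v eq[of v] by (auto simp: F_def norm_sgn sgn_div_norm field_simps)
    have "norm (G *v v) \<le> l"
      using feas[of v] F(3) v by simp
    then have "(norm (G *v v))\<^sup>2 \<le> l\<^sup>2"
      by (intro power_mono) auto
    \<comment> \<open>Equality case of Cauchy-Schwarz: the right side is at most l^2 - 2 l^2 + l^2 =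
      0.\<close>
    moreover have "(norm (G *v v - l *\<^sub>R ?u))\<^sup>2 = (norm (G *v v))\<^sup>2 - 2 * l * ((G *v v) \<bullet> ?u) + l\<^sup>2 * (norm ?u)\<^sup>2"
      by (simp only: power2_norm_eq_inner) (simp add: inner_simps inner_commute power2_eq_square algebra_simps)
    ultimately have "(norm (G *v v - l *\<^sub>R ?u))\<^sup>2 \<le> 0"
      by (simp add: u power2_eq_square)
    then show ?thesis
      by simp
  qed
  show thesis
  proof (rule that[of "span F"])
    show "dim (span F) = rank B"
      using orthonormal_independent[OF F(2,3)] card_right_singular_basis_nonzero[OF E]
      by (simp add: dim_eq_card_independent F_def)
    fix x assume x: "x \<in> span F"
    have xs: "(\<Sum>v\<in>F. (x \<bullet> v) *\<^sub>R v) = x"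
      using F x by (intro orthonormal_basis_expand) auto
    have "G *v x = G *v (\<Sum>v\<in>F. (x \<bullet> v) *\<^sub>R v)"
      by (simp add: xs)
    also have "\<dots> = (\<Sum>v\<in>F. (x \<bullet> v) *\<^sub>R (l *\<^sub>R sgn (B *v v)))"
      by (simp add: linear_sum[OF matrix_vector_mul_linear] linear_scale[OF matrix_vector_mul_linear] G)
    also have "\<dots> = l *\<^sub>R (\<Sum>v\<in>F. (x \<bullet> v) *\<^sub>R sgn (B *v v))"
      by (simp add: scaleR_sum_right mult.commute)
    finally have "norm (G *v x) = l * norm (\<Sum>v\<in>F. (x \<bullet> v) *\<^sub>R sgn (B *v v))"
      using l by simp
    also have "norm (\<Sum>v\<in>F. (x \<bullet> v) *\<^sub>R sgn (B *v v)) = norm (\<Sum>v\<in>F. (x \<bullet> v) *\<^sub>R v)"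
      using F by (intro norm_sum_orthogonal_eq) (auto simp: F_def norm_sgn sgn_div_norm pairwise_def orthogonal_def)
    finally show "norm (G *v x) = l * norm x"
      by (simp add: xs)
  qed simp
qed

section \<open>Comparison of the scaled residual with the scaled data\<close>

lemma norm_mult_le_norm:
  fixes M :: "real^'q^'p"
  shows "norm (M *v x) \<le> norm M * norm x"
proof -
  have "(norm (M *v x))\<^sup>2 = (\<Sum>i\<in>UNIV. (M $ i \<bullet> x)\<^sup>2)"
    by (simp add: norm_vec_def L2_set_def sum_nonneg matrix_vector_mul_component)
  also have "\<dots> \<le> (\<Sum>i\<in>UNIV. (norm (M $ i))\<^sup>2 * (norm x)\<^sup>2)"
    by (intro sum_mono) (metis Cauchy_Schwarz_ineq power2_norm_eq_inner)
  also have "\<dots> = (norm M * norm x)\<^sup>2"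
    by (simp add: sum_distrib_right[symmetric] power_mult_distrib norm_vec_def[of M] L2_set_def sum_nonneg)
  finally show ?thesis
    by (simp add: power2_le_iff_abs_le)
qed

text \<open>The residual \<open>(Y - X B) / l\<close> is the projection of \<open>Y / l\<close> onto the dual feasible set
  \<open>{\<theta>. \<parallel>X\<^sup>T \<theta>\<parallel>\<^sub>2 \<le> 1}\<close>, so it is no further from a feasible point \<open>z\<close> than \<open>Y / l\<close> is.\<close>

lemma nn_solution_residual_dist:
  fixes X :: "real^'p^'n"
  assumes sol: "nn_solution X Y l B" and l: "0 < l"
    and z: "\<And>x. norm ((transpose X ** z) *v x) \<le> norm x"
  shows "norm ((1 / l) *\<^sub>R (Y - X ** B) - z) \<le> norm ((1 / l) *\<^sub>R Y - z)"
proof -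
  define P where "P = (1 / l) *\<^sub>R (Y - X ** B)"
  have W: "(1 / l) *\<^sub>R Y = P + (1 / l) *\<^sub>R (X ** B)"
    by (simp add: P_def scaleR_diff_right)
  have "(Y - X ** B) \<bullet> (X ** B) = l * nuclear_norm B"
    using nn_solution_dual_attained[OF sol] l by (simp add: inner_transpose_mult)
  then have "P \<bullet> (X ** B) = nuclear_norm B"
    using l by (simp add: P_def)
  moreover have "(transpose X ** z) \<bullet> B \<le> 1 * nuclear_norm B"
    using z by (intro inner_le_nuclear_norm) simp
  then have "z \<bullet> (X ** B) \<le> nuclear_norm B"
    by (simp add: inner_transpose_mult)
  \<comment> \<open>The variational inequality of the projection: X B / l is the displacement from P
    to Y / l.\<close>
  ultimately have "0 \<le> (1 / l) * ((P - z) \<bullet> (X ** B))"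
    using l by (simp add: inner_diff_left)
  then have "0 \<le> (P - z) \<bullet> ((1 / l) *\<^sub>R (X ** B))"
    by simp
  moreover have "(norm ((P - z) + (1 / l) *\<^sub>R (X ** B)))\<^sup>2
      = (norm (P - z))\<^sup>2 + 2 * ((P - z) \<bullet> ((1 / l) *\<^sub>R (X ** B))) + (norm ((1 / l) *\<^sub>R (X ** B)))\<^sup>2"
    by (simp only: power2_norm_eq_inner inner_add_left inner_add_right) (simp add: inner_commute)
  ultimately have "(norm (P - z))\<^sup>2 \<le> (norm ((P - z) + (1 / l) *\<^sub>R (X ** B)))\<^sup>2"
    by simp
  then show ?thesis
    unfolding P_def[symmetric] W by (simp add: power2_le_iff_abs_le algebra_simps)
qed

text \<open>On V the map X^T P preserves norms, while X^T z is X^T Y / s. Replacing P by z costs at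
  most ||X||_2 times the distance of P and z, so X^T Y cannot shrink V much below the factor
  s.\<close>

lemma singular_value_ge_of_rank:
  fixes X :: "real^'p^'n" and Y :: "real^'q^'n"
  defines "s \<equiv> spectral_norm (transpose X ** Y)"
  assumes sol: "nn_solution X Y l B" and l: "0 < l" "l \<le> s"
    and i: "i \<in> {1..min CARD('p) CARD('q)}" "i \<le> rank B"
  shows "s * (1 - spectral_norm X * norm Y * (1 / l - 1 / s)) \<le> singular_value (transpose X ** Y) i"
proof -
  let ?M = "transpose X ** Y"
  define P where "P = (1 / l) *\<^sub>R (Y - X ** B)"
  define z where "z = (1 / s) *\<^sub>R Y"
  have s: "0 < s"
    using l by simp
  have zv: "transpose X *v (z *v x) = (1 / s) *\<^sub>R (?M *v x)" for x
    by (simp add: z_def linear_scale[OF matrix_vector_mul_linear] matrix_vector_mul_assoc[symmetric]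
        scaleR_matrix_vector_assoc[symmetric] del: transpose_matrix_vector)
  have nz: "norm (transpose X *v (z *v x)) = norm (?M *v x) / s" for x
    unfolding zv using s by simp
  have "norm ((transpose X ** z) *v x) \<le> norm x" for x
    using norm_mult_le_spectral_norm[of ?M x] s nz[of x]
    by (simp add: s_def[symmetric] matrix_vector_mul_assoc[symmetric] divide_le_eq mult.commute del: transpose_matrix_vector)
  from nn_solution_residual_dist[OF sol l(1) this]
  have "norm (P - z) \<le> norm ((1 / l - 1 / s) *\<^sub>R Y)"
    by (simp add: P_def z_def scaleR_diff_left)
  moreover have "1 / s \<le> 1 / l"
    using l by (simp add: frac_le)
  ultimately have dist: "norm (P - z) \<le> (1 / l - 1 / s) * norm Y"
    by simp
  obtain V where V: "subspace V" "dim V = rank B"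
      "\<And>v. v \<in> V \<Longrightarrow> norm ((transpose X ** (Y - X ** B)) *v v) = l * norm v"
    using isometric_subspace_of_dual[OF _ nn_solution_dual_feasible[OF sol] nn_solution_dual_attained[OF sol]] l(1)
    by (metis less_imp_le)
  show ?thesis
  proof (rule singular_value_ge[OF V(1) _ i(1)])
    show "i \<le> dim V"
      using i(2) V(2) by simp
    fix v assume v: "v \<in> V"
    have "transpose X *v (P *v v) = (1 / l) *\<^sub>R ((transpose X ** (Y - X ** B)) *v v)"
      by (simp add: P_def linear_scale[OF matrix_vector_mul_linear] matrix_vector_mul_assoc[symmetric]
          scaleR_matrix_vector_assoc[symmetric] del: transpose_matrix_vector)
    then have "norm v = norm (transpose X *v (P *v v))"
      using V(3)[OF v] l(1) by simp
    also have "P *v v = (P - z) *v v + z *v v"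
      by (simp add: matrix_vector_mult_diff_rdistrib)
    also have "norm (transpose X *v \<dots>) \<le> norm (transpose X *v ((P - z) *v v)) + norm (transpose X *v (z *v v))"
      by (simp add: matrix_vector_right_distrib norm_triangle_ineq del: transpose_matrix_vector)
    also have "norm (transpose X *v ((P - z) *v v)) \<le> spectral_norm X * ((1 / l - 1 / s) * norm Y * norm v)"
    proof -
      have "norm ((P - z) *v v) \<le> (1 / l - 1 / s) * norm Y * norm v"
        using norm_mult_le_norm[of "P - z" v] dist by (meson mult_right_mono norm_ge_zero order_trans)
      moreover have "0 \<le> spectral_norm X"
        unfolding spectral_norm_def by (rule singular_value_nonneg) (simp add: Suc_leI)
      ultimately show ?thesis
        using norm_transpose_mult_le_spectral_norm[of X "(P - z) *v v"] by (meson mult_left_mono order_trans)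
    qed
    finally have "norm v - spectral_norm X * ((1 / l - 1 / s) * norm Y * norm v) \<le> norm (?M *v v) / s"
      by (simp add: nz del: transpose_matrix_vector)
    then have "s * (norm v - spectral_norm X * ((1 / l - 1 / s) * norm Y * norm v)) \<le> norm (?M *v v)"
      using s by (simp add: pos_le_divide_eq mult.commute)
    then show "s * (1 - spectral_norm X * norm Y * (1 / l - 1 / s)) * norm v \<le> norm (?M *v v)"
      using s by (simp add: algebra_simps)
  qed
qed

theorem theorem3p2:
  fixes X :: "real^'p^'n" and Y :: "real^'q^'n" and B :: "real^'q^'p"
    and i :: nat and l :: real
  assumes "\<exists>j\<in>{1..min CARD('p) CARD('q)}. \<exists>k\<in>{1..min CARD('p) CARD('q)}.
             singular_value (transpose X ** Y) j \<noteq> singular_value (transpose X ** Y) k"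
    and "i \<in> {2..min CARD('p) CARD('q)}"
    and "l \<in> {lambda_bound X Y i <.. lambda_bound X Y (i - 1)}"
    and "nn_solution X Y l B"
  shows "rank B \<le> i - 1"
proof (rule ccontr)
  assume "\<not> rank B \<le> i - 1"
  then have rank: "i \<le> rank B"
    by simp
  define \<sigma> where "\<sigma> = singular_value (transpose X ** Y)"
  define a where "a = spectral_norm X * norm Y"
  have i: "i \<in> {1..min CARD('p) CARD('q)}" "i - 1 \<in> {1..min CARD('p) CARD('q)}"
    using assms(2) by auto
  have le1: "\<sigma> k \<le> \<sigma> 1" and nonneg: "0 \<le> \<sigma> k" if "k \<in> {1..min CARD('p) CARD('q)}" for k
    unfolding \<sigma>_def using that
    by (intro singular_value_antimono singular_value_nonneg; simp)+
  obtain j k where jk: "j \<in> {1..min CARD('p) CARD('q)}" "k \<in> {1..min CARD('p) CARD('q)}" "\<sigma> j \<noteq> \<sigma> k"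
    using assms(1) unfolding \<sigma>_def by blast
  \<comment> \<open>Of two different nonnegative singular values one is positive, and
    \<open>\<sigma> 1\<close> dominates it.\<close>
  have s: "0 < \<sigma> 1"
    using le1[OF jk(1)] le1[OF jk(2)] nonneg[OF jk(1)] nonneg[OF jk(2)] jk(3) by linarith
  have a: "0 < a"
  proof -
    have "0 \<le> spectral_norm X"
      unfolding spectral_norm_def by (rule singular_value_nonneg) (simp add: Suc_leI)
    \<comment> \<open>If a = 0 then X or Y acts as zero, so X^T Y = 0, against
      \<open>\<sigma> 1\<close> > 0.\<close>
    moreover have "a \<noteq> 0"
    proof
      assume "a = 0"
      then have "norm ((transpose X ** Y) *v x) \<le> 0" for x
        using norm_transpose_mult_le_spectral_norm[of X "Y *v x"]
        by (auto simp: a_def matrix_vector_mul_assoc[symmetric] simp del: transpose_matrix_vector)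
      then have "transpose X ** Y = 0"
        by (simp add: matrix_eq)
      moreover obtain v where "\<sigma> 1 = norm ((transpose X ** Y) *v v)"
        unfolding \<sigma>_def by (rule singular_value_attained[of 1]) (auto simp: Suc_leI)
      ultimately show False
        using s by simp
    qed
    ultimately show ?thesis
      by (simp add: a_def less_le)
  qed
  have bound: "lambda_bound X Y k = \<sigma> 1 * a / (\<sigma> 1 - \<sigma> k + a)" for k
    by (simp add: lambda_bound_def spectral_norm_def \<sigma>_def a_def frobenius_norm_eq_norm mult.assoc)
  have den: "0 < \<sigma> 1 - \<sigma> k + a" if "k \<in> {1..min CARD('p) CARD('q)}" for k
    using le1[OF that] a by simp
  have "0 < \<sigma> 1 * a / (\<sigma> 1 - \<sigma> i + a)"
    using s a den[OF i(1)] by simp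
  then have l: "\<sigma> 1 * a / (\<sigma> 1 - \<sigma> i + a) < l" "0 < l" "l \<le> \<sigma> 1 * a / (\<sigma> 1 - \<sigma> (i - 1) + a)"
    using assms(3) unfolding bound by auto
  \<comment> \<open>The denominator is at least a. Thus the upper end of the interval yields l \<le>
    \<open>\<sigma> 1\<close>, as the comparison with Y / s demands.\<close>
  have "\<sigma> 1 * a / (\<sigma> 1 - \<sigma> (i - 1) + a) \<le> \<sigma> 1"
    using den[OF i(2)] le1[OF i(2)] s by (simp add: divide_le_eq)
  then have ls: "l \<le> \<sigma> 1"
    using l(3) by simp
  have "\<sigma> 1 * (1 - a * (1 / l - 1 / \<sigma> 1)) \<le> \<sigma> i"
    using singular_value_ge_of_rank[OF assms(4) l(2) _ i(1) rank] ls
    by (simp add: spectral_norm_def \<sigma>_def a_def)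
  then have "l * (\<sigma> 1 * (1 - a * (1 / l - 1 / \<sigma> 1))) \<le> l * \<sigma> i"
    using l(2) by (intro mult_left_mono) auto
  \<comment> \<open>Clearing denominators turns the lower bound on \<open>\<sigma> i\<close> into l
    \<le> lambda_i, contrary to the strict lower end of the interval.\<close>
  moreover have "l * (\<sigma> 1 * (1 - a * (1 / l - 1 / \<sigma> 1))) = l * \<sigma> 1 - a * \<sigma> 1 + a * l"
    using l(2) s by (simp add: field_simps)
  ultimately have "l * (\<sigma> 1 - \<sigma> i + a) \<le> \<sigma> 1 * a"
    by (simp add: algebra_simps)
  then show False
    using l(1) den[OF i(1)] by (simp add: pos_divide_less_eq)
qed

end
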